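(* Let $\boldsymbol{Y}\in\mathbb{C}^{M\times L}$ be an observation matrix with sample covariance matrix $\boldsymbol{R}=\frac1L\boldsymbol{Y}\boldsymbol{Y}^*$, whose eigenvalues $\lambda_1,\dots,\lambda_M$ lie in a compact interval of the positive real axis. The high-dimensional decision statistic $\hat\eta$ associated with the linear function $g(z)=z$ has the form $$\hat\eta = T_{HDL}=\frac1M\operatorname{tr}(\boldsymbol{R})=\frac1M\sum_{i=1}^M\lambda_i .$$
   Context: For a complex function $g$, analytic on the positive real axis, the high-dimensional decision statistic associated with the linear spectral statistic $\frac1M\sum_{i=1}^M g(\lambda_i)$ is $$\hat\eta=\Big(1-\frac LM\Big)\frac{1}{2\pi j}\oint_{\mathcal C}\frac{g(z)}{z}\,dz+\frac LM\cdot\frac{1}{2\pi j}\oint_{\mathcal C}\frac{\phi_M(\omega)}{\omega}\,\psi_M(\omega)\,d\omega,$$ where $j=\sqrt{-1}$, $$z_M(\omega)=\omega\Big(1-\frac1L\sum_{i=1}^M\frac{\lambda_i}{\lambda_i-\omega}\Big),\qquad \phi_M(\omega)=g(z_M(\omega)),\qquad \psi_M(\omega)=\frac{dz_M(\omega)}{d\omega}=1-\frac1L\sum_{i=1}^M\frac{\lambda_i^2}{(\lambda_i-\omega)^2},$$ and $\mathcal C$ is a positively oriented simple closed contour enclosing all the eigenvalues $\lambda_1,\dots,\lambda_M$ of $\boldsymbol{R}$. Here $M$ is the number of antennas and $L$ the number of samples. *)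

theory Defs
  imports
    "HOL-Complex_Analysis.Complex_Analysis"
    "Jordan_Normal_Form.Schur_Decomposition"
begin

definition sample_covariance :: "nat \<Rightarrow> complex mat \<Rightarrow> complex mat" where
  "sample_covariance L Y = (1 / of_nat L) \<cdot>\<^sub>m (Y * mat_adjoint Y)"

definition mat_trace :: "complex mat \<Rightarrow> complex" where
  "mat_trace A = (\<Sum>i<dim_row A. A $$ (i, i))"

text \<open>The numbers \<open>lam 1, \<dots>, lam M\<close> are the eigenvalues of the \<open>M \<times> M\<close> matrix \<open>A\<close>, each listed
  as often as its algebraic multiplicity.\<close>

definition lists_eigenvalues :: "complex mat \<Rightarrow> nat \<Rightarrow> (nat \<Rightarrow> real) \<Rightarrow> bool" where
  "lists_eigenvalues A M lam \<longleftrightarrow>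
     A \<in> carrier_mat M M \<and> char_poly A = (\<Prod>i=1..M. [:- complex_of_real (lam i), 1:])"

definition positive_simple_closed_contour :: "(real \<Rightarrow> complex) \<Rightarrow> bool" where
  "positive_simple_closed_contour C \<longleftrightarrow>
     valid_path C \<and> simple_path C \<and> pathfinish C = pathstart C \<and>
     (\<forall>z \<in> inside (path_image C). winding_number C z = 1)"

definition z_fun :: "nat \<Rightarrow> nat \<Rightarrow> (nat \<Rightarrow> real) \<Rightarrow> complex \<Rightarrow> complex" where
  "z_fun M L lam \<omega> =
     \<omega> * (1 - 1 / of_nat L * (\<Sum>i=1..M. of_real (lam i) / (of_real (lam i) - \<omega>)))"

definition phi_fun ::
    "(complex \<Rightarrow> complex) \<Rightarrow> nat \<Rightarrow> nat \<Rightarrow> (nat \<Rightarrow> real) \<Rightarrow> complex \<Rightarrow> complex" where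
  "phi_fun g M L lam \<omega> = g (z_fun M L lam \<omega>)"

definition psi_fun :: "nat \<Rightarrow> nat \<Rightarrow> (nat \<Rightarrow> real) \<Rightarrow> complex \<Rightarrow> complex" where
  "psi_fun M L lam \<omega> = deriv (z_fun M L lam) \<omega>"

lemma psi_fun_eq:
  assumes "\<And>i. i \<in> {1..M} \<Longrightarrow> \<omega> \<noteq> of_real (lam i)"
  shows "psi_fun M L lam \<omega> =
    1 - 1 / of_nat L * (\<Sum>i=1..M. (of_real (lam i))\<^sup>2 / (of_real (lam i) - \<omega>)\<^sup>2)"
proof -
  have z_eq: "z_fun M L lam =
      (\<lambda>\<omega>. \<omega> - 1 / of_nat L * (\<Sum>i=1..M. of_real (lam i) * \<omega> / (of_real (lam i) - \<omega>)))"
    by (rule ext) (simp add: z_fun_def algebra_simps sum_distrib_left)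
  have summand: "((\<lambda>\<omega>. of_real (lam i) * \<omega> / (of_real (lam i) - \<omega>)) has_field_derivative
      (of_real (lam i))\<^sup>2 / (of_real (lam i) - \<omega>)\<^sup>2) (at \<omega>)" if "i \<in> {1..M}" for i
  proof -
    have "of_real (lam i) - \<omega> \<noteq> 0"
      using assms[OF that] by simp
    then show ?thesis
      by (auto intro!: derivative_eq_intros simp: power2_eq_square algebra_simps)
  qed
  have "(z_fun M L lam has_field_derivative
      1 - 1 / of_nat L * (\<Sum>i=1..M. (of_real (lam i))\<^sup>2 / (of_real (lam i) - \<omega>)\<^sup>2)) (at \<omega>)"
    unfolding z_eq by (intro DERIV_diff DERIV_ident DERIV_cmult DERIV_sum summand)
  then show ?thesis
    unfolding psi_fun_def by (rule DERIV_imp_deriv)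
qed

definition eta_hat ::
    "(complex \<Rightarrow> complex) \<Rightarrow> nat \<Rightarrow> nat \<Rightarrow> (nat \<Rightarrow> real) \<Rightarrow> (real \<Rightarrow> complex) \<Rightarrow> complex" where
  "eta_hat g M L lam C =
     (1 - of_nat L / of_nat M) * (1 / (2 * of_real pi * \<i>)) *
       contour_integral C (\<lambda>z. g z / z) +
     of_nat L / of_nat M * (1 / (2 * of_real pi * \<i>)) *
       contour_integral C (\<lambda>\<omega>. phi_fun g M L lam \<omega> / \<omega> * psi_fun M L lam \<omega>)"

definition T_HDL :: "complex mat \<Rightarrow> complex" where
  "T_HDL R = 1 / of_nat (dim_row R) * mat_trace R"

end

theory Submission
  imports Defs
begin

text \<open>For \<open>g z = z\<close> the factor \<open>z_M / \<omega>\<close> is \<open>1 - S\<^sub>1\<close> and \<open>\<psi>_M\<close> is \<open>1 - S\<^sub>2\<close>, where \<open>S\<^sub>1\<close> has simple and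
  \<open>S\<^sub>2\<close> pure double poles at the eigenvalues. The first contour integral and the one of \<open>S\<^sub>2\<close> vanish because
  the integrands have primitives. The product \<open>S\<^sub>1 S\<^sub>2\<close> decays like \<open>\<omega>\<^sup>-\<^sup>3\<close> and all its poles are enclosed, so
  its integral vanishes as well; concretely, its partial fractions have residues cancelling in pairs.
  Only \<open>- S\<^sub>1\<close> contributes, with residue sum \<open>1 / L * (\<Sum>i. \<lambda>\<^sub>i)\<close>, and the sum of the eigenvalues is the trace
  by Schur triangularisation.\<close>

lemma mat_trace_mult_commute:
  assumes "A \<in> carrier_mat n m" "B \<in> carrier_mat m n"
  shows "mat_trace (A * B) = mat_trace (B * A)"
proof -
  have "mat_trace (A * B) = (\<Sum>i<n. \<Sum>k<m. A $$ (i, k) * B $$ (k, i))"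
    using assms unfolding mat_trace_def by (auto simp: scalar_prod_def atLeast0LessThan intro!: sum.cong)
  also have "\<dots> = (\<Sum>k<m. \<Sum>i<n. B $$ (k, i) * A $$ (i, k))"
    by (subst sum.swap) (simp add: mult.commute)
  also have "\<dots> = mat_trace (B * A)"
    using assms unfolding mat_trace_def by (auto simp: scalar_prod_def atLeast0LessThan intro!: sum.cong)
  finally show ?thesis .
qed

text \<open>Schur triangularisation writes \<open>A = P * B * Q\<close>, where \<open>B\<close>
  carries the roots on its diagonal; cyclicity of the trace brings \<open>Q\<close> next to
  \<open>P\<close>, and the two cancel.\<close>

lemma mat_trace_eq_sum_list_roots:
  assumes A: "A \<in> carrier_mat n n"
    and cp: "char_poly A = (\<Prod>e\<leftarrow>es. [:- e, 1:])"
  shows "mat_trace A = sum_list es"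
proof -
  obtain B P Q where schur: "schur_decomposition A es = (B, P, Q)"
    by (metis prod_cases3)
  have sim: "similar_mat_wit A B P Q" and diag: "diag_mat B = es"
    using schur_decomposition[OF A cp schur] by auto
  note w = similar_mat_witD2[OF A sim]
  have "mat_trace A = mat_trace (P * (B * Q))"
    using w by (simp add: assoc_mult_mat[of P n n B n Q n])
  also have "\<dots> = mat_trace (B * Q * P)"
    using w by (intro mat_trace_mult_commute[of _ n n]) auto
  also have "B * Q * P = B"
    using w by (simp add: assoc_mult_mat[of B n n Q n P n])
  also have "mat_trace B = sum_list (diag_mat B)"
    by (simp add: mat_trace_def diag_mat_def interv_sum_list_conv_sum_set_nat atLeast0LessThan)
  finally show ?thesis
    using diag by simp
qed

lemma mat_trace_eq_sum_eigenvalues: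
  assumes "lists_eigenvalues A M lam"
  shows "mat_trace A = (\<Sum>i=1..M. complex_of_real (lam i))"
proof -
  let ?es = "map (\<lambda>i. complex_of_real (lam i)) [1..<Suc M]"
  have set: "set [1..<Suc M] = {1..M}"
    by auto
  have "char_poly A = (\<Prod>e\<leftarrow>?es. [:- e, 1:])"
    using assms prod.distinct_set_conv_list[of "[1..<Suc M]" "\<lambda>i. [:- complex_of_real (lam i), 1:]"]
    unfolding lists_eigenvalues_def set by (simp add: o_def)
  moreover have "A \<in> carrier_mat M M"
    using assms by (simp add: lists_eigenvalues_def)
  ultimately have "mat_trace A = sum_list ?es"
    by (intro mat_trace_eq_sum_list_roots)
  then show ?thesis
    using sum.distinct_set_conv_list[of "[1..<Suc M]" "\<lambda>i. complex_of_real (lam i)"]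
    unfolding set by simp
qed

lemma has_contour_integral_const_loop:
  assumes "valid_path g" "pathfinish g = pathstart g"
  shows "((\<lambda>_. c) has_contour_integral 0) g"
  by (rule Cauchy_theorem_primitive[of UNIV "\<lambda>w. c * w"])
     (use assms in \<open>auto intro!: derivative_eq_intros\<close>)

text \<open>From exponent 2 on, the power has a single-valued primitive on the complement of
  \<open>p\<close>, which takes equal values at both ends of the loop.\<close>

lemma has_contour_integral_inverse_power_loop:
  assumes "valid_path g" "pathfinish g = pathstart g" "p \<notin> path_image g" "n \<ge> 2"
  shows "((\<lambda>w. 1 / (w - p) ^ n) has_contour_integral 0) g"
proof -
  \<comment> \<open>Writing \<open>n\<close> as \<open>k + 2\<close> keeps the exponent
    \<open>k + 1\<close> of the primitive free of truncated subtraction.\<close>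
  obtain k where n: "n = k + 2"
    using \<open>n \<ge> 2\<close> by (metis le_add_diff_inverse2)
  have "((\<lambda>w. 1 / (w - p) ^ (k + 2)) has_contour_integral 0) g"
  proof (rule Cauchy_theorem_primitive)
    show "((\<lambda>w. - 1 / (of_nat (k + 1) * (w - p) ^ (k + 1))) has_field_derivative 1 / (w - p) ^ (k + 2))
        (at w within - {p})" if "w \<in> - {p}" for w
    proof -
      have nz: "w - p \<noteq> 0" "of_nat (k + 1) \<noteq> (0 :: complex)"
        using that of_nat_neq_0[of k, where ?'a = complex] by simp_all
      show ?thesis
        by (rule derivative_eq_intros refl | use nz in simp)+
    qed
  qed (use assms in auto)
  then show ?thesis
    by (simp only: n)
qed

text \<open>For distinct poles the residues at \<open>p\<close> and \<open>q\<close> are opposite,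
  so equal winding numbers cancel them. Coinciding poles merge into a triple pole, which has a
  primitive.\<close>

lemma has_contour_integral_simple_times_double_pole:
  assumes g: "valid_path g" "pathfinish g = pathstart g"
    and p: "p \<notin> path_image g" and q: "q \<notin> path_image g"
    and wn: "winding_number g p = winding_number g q"
  shows "((\<lambda>w. 1 / (w - p) * (1 / (w - q)\<^sup>2)) has_contour_integral 0) g"
proof (cases "p = q")
  case True
  have "((\<lambda>w. 1 / (w - q) ^ 3) has_contour_integral 0) g"
    by (rule has_contour_integral_inverse_power_loop[OF g q]) simp
  then show ?thesis
    using True by (simp add: power_numeral_reduce)
next
  case False
  let ?d = "p - q"
  \<comment> \<open>This is the partial fraction form of the integrand; its pure double pole at
    \<open>q\<close> contributes 0.\<close>
  have "((\<lambda>w. 1 / ?d\<^sup>2 * (1 / (w - p) - 1 / (w - q)) - 1 / ?d * (1 / (w - q)\<^sup>2))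
      has_contour_integral
      1 / ?d\<^sup>2 * (2 * pi * \<i> * winding_number g p - 2 * pi * \<i> * winding_number g q) - 1 / ?d * 0) g"
    by (intro has_contour_integral_diff has_contour_integral_lmul
        has_contour_integral_inverse_power_loop has_contour_integral_winding_number g p q order_refl)
  then have "((\<lambda>w. 1 / ?d\<^sup>2 * (1 / (w - p) - 1 / (w - q)) - 1 / ?d * (1 / (w - q)\<^sup>2))
      has_contour_integral 0) g"
    by (simp add: wn)
  moreover have "1 / ?d\<^sup>2 * (1 / (w - p) - 1 / (w - q)) - 1 / ?d * (1 / (w - q)\<^sup>2)
      = 1 / (w - p) * (1 / (w - q)\<^sup>2)" if "w \<in> path_image g" for w
  proof -
    have nz: "?d \<noteq> 0" "w - p \<noteq> 0" "w - q \<noteq> 0"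
      using False p q that by auto
    \<comment> \<open>The resolvent identity \<open>diff\<close>, used once in each direction of the
      degree, turns the partial fractions back into the product.\<close>
    define x y where "x = 1 / (w - p)" and "y = 1 / (w - q)"
    have diff: "x - y = ?d * (x * y)"
      using nz by (simp add: x_def y_def divide_simps)
    have "1 / ?d\<^sup>2 * (x - y) - 1 / ?d * y\<^sup>2 = 1 / ?d * (x * y) - 1 / ?d * y\<^sup>2"
      unfolding diff using nz(1) by (simp only: power2_eq_square) simp
    also have "\<dots> = 1 / ?d * y * (x - y)"
      by (simp only: power2_eq_square right_diff_distrib left_diff_distrib mult_ac)
    also have "\<dots> = x * y\<^sup>2"
      unfolding diff using nz(1) by (simp add: power2_eq_square)
    finally show ?thesis
      by (simp only: x_def y_def power_one_over)
  qed
  ultimately show ?thesis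
    by (rule has_contour_integral_eq)
qed

lemma has_contour_integral_pole_sum_product:
  fixes p :: "'i \<Rightarrow> complex"
  assumes g: "valid_path g" "pathfinish g = pathstart g" and I: "finite I"
    and p: "\<And>i. i \<in> I \<Longrightarrow> p i \<notin> path_image g"
    and wn: "\<And>i. i \<in> I \<Longrightarrow> winding_number g (p i) = 1"
  shows "((\<lambda>w. (1 - c * (\<Sum>i\<in>I. p i / (p i - w))) * (1 - c * (\<Sum>i\<in>I. (p i)\<^sup>2 / (p i - w)\<^sup>2)))
    has_contour_integral 2 * of_real pi * \<i> * c * (\<Sum>i\<in>I. p i)) g"
proof -
  \<comment> \<open>Poles are written with \<open>w - p i\<close>, as in the lemmas above. This
    flips the sign of the simple poles but not of the squares, hence \<open>1 + c * ?S1 w\<close>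
    and \<open>- c * ?S2 w\<close> in the expansion.\<close>
  let ?S1 = "\<lambda>w. \<Sum>i\<in>I. p i * (1 / (w - p i))"
  let ?S2 = "\<lambda>w. \<Sum>i\<in>I. (p i)\<^sup>2 * (1 / (w - p i)\<^sup>2)"
  let ?S3 = "\<lambda>w. \<Sum>i\<in>I. \<Sum>j\<in>I. p i * (p j)\<^sup>2 * (1 / (w - p i) * (1 / (w - p j)\<^sup>2))"
  have pole: "((\<lambda>w. 1 / (w - p i)) has_contour_integral 2 * of_real pi * \<i>) g" if "i \<in> I" for i
    using has_contour_integral_winding_number[OF g(1) p[OF that]] wn[OF that] by simp
  have "((\<lambda>w. 1 + c * ?S1 w - c * ?S2 w - c\<^sup>2 * ?S3 w) has_contour_integral
      0 + c * (\<Sum>i\<in>I. p i * (2 * of_real pi * \<i>)) - c * (\<Sum>i\<in>I. (p i)\<^sup>2 * 0)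
        - c\<^sup>2 * (\<Sum>i\<in>I. \<Sum>j\<in>I. p i * (p j)\<^sup>2 * 0)) g"
    by (intro has_contour_integral_add has_contour_integral_diff has_contour_integral_lmul
        has_contour_integral_sum has_contour_integral_const_loop pole
        has_contour_integral_inverse_power_loop has_contour_integral_simple_times_double_pole I g p order_refl)
       (simp_all add: wn)
  moreover have "0 + c * (\<Sum>i\<in>I. p i * (2 * of_real pi * \<i>))
        - c * (\<Sum>i\<in>I. (p i)\<^sup>2 * 0) - c\<^sup>2 * (\<Sum>i\<in>I. \<Sum>j\<in>I. p i * (p j)\<^sup>2 * 0)
      = 2 * of_real pi * \<i> * c * (\<Sum>i\<in>I. p i)"
    unfolding sum_distrib_right[symmetric] by simp
  moreover have "(\<lambda>w. 1 + c * ?S1 w - c * ?S2 w - c\<^sup>2 * ?S3 w) =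
    (\<lambda>w. (1 - c * (\<Sum>i\<in>I. p i / (p i - w))) * (1 - c * (\<Sum>i\<in>I. (p i)\<^sup>2 / (p i - w)\<^sup>2)))"
  proof
    fix w
    have "p i / (p i - w) = - (p i * (1 / (w - p i)))" for i
      using minus_divide_right[of "p i" "w - p i"] by simp
    then have S1: "(\<Sum>i\<in>I. p i / (p i - w)) = - ?S1 w"
      by (simp only: sum_negf)
    have S2: "(\<Sum>i\<in>I. (p i)\<^sup>2 / (p i - w)\<^sup>2) = ?S2 w"
      by (simp add: power2_commute)
    have S3: "?S3 w = ?S1 w * ?S2 w"
      by (simp add: sum_product mult_ac)
    show "1 + c * ?S1 w - c * ?S2 w - c\<^sup>2 * ?S3 w =
      (1 - c * (\<Sum>i\<in>I. p i / (p i - w))) * (1 - c * (\<Sum>i\<in>I. (p i)\<^sup>2 / (p i - w)\<^sup>2))"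
      unfolding S1 S2 S3 by (simp add: algebra_simps power2_eq_square)
  qed
  ultimately show ?thesis
    by (simp only:)
qed

text \<open>Injectivity on the open interval leaves at most one interior parameter; only the
  endpoints 0 and 1 can be added to it.\<close>

lemma finite_simple_path_preimage:
  assumes "simple_path g"
  shows "finite {t \<in> {0..1}. g t = z}"
proof -
  have "inj_on g ({t \<in> {0..1}. g t = z} \<inter> {0<..<1})"
    using simple_path_inj_on[OF assms] by (auto simp: inj_on_def)
  moreover have "finite (g ` ({t \<in> {0..1}. g t = z} \<inter> {0<..<1}))"
    by (rule finite_subset[of _ "{z}"]) auto
  ultimately have "finite ({t \<in> {0..1}. g t = z} \<inter> {0<..<1})"
    using finite_imageD by blast
  then show ?thesis
    by (rule finite_subset[rotated, OF finite_UnI[of _ "{0, 1}"]]) auto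
qed

text \<open>Changing the integrand at the single point \<open>z\<close> affects finitely many
  parameters, which the integral over \<open>{0..1}\<close> ignores.\<close>

lemma has_contour_integral_spike_simple_path:
  assumes "simple_path g" and f: "(f has_contour_integral y) g"
    and eq: "\<And>w. w \<in> path_image g \<Longrightarrow> w \<noteq> z \<Longrightarrow> h w = f w"
  shows "(h has_contour_integral y) g"
  unfolding has_contour_integral_def
proof (rule has_integral_spike_finite)
  show "finite {t \<in> {0..1}. g t = z}"
    by (rule finite_simple_path_preimage) fact
  show "((\<lambda>x. f (g x) * vector_derivative g (at x within {0..1})) has_integral y) {0..1}"
    using f unfolding has_contour_integral_def .
qed (auto simp: eq path_image_def)

text \<open>The contour may pass through the origin, where \<open>g z / z\<close> and \<open>\<phi>_M / \<omega>\<close> take the junk value \<open>0\<close>;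
  a simple path does so for finitely many parameters only, hence the spike lemma.\<close>

lemma eta_hat_ident:
  assumes M: "M \<ge> 1" and L: "L \<ge> 1"
    and C: "positive_simple_closed_contour C"
    and lam: "\<forall>i\<in>{1..M}. complex_of_real (lam i) \<in> inside (path_image C)"
  shows "eta_hat (\<lambda>z. z) M L lam C = 1 / of_nat M * (\<Sum>i=1..M. complex_of_real (lam i))"
proof -
  let ?S = "\<Sum>i=1..M. complex_of_real (lam i)"
  have C': "valid_path C" "simple_path C" "pathfinish C = pathstart C"
    and wn: "\<And>i. i \<in> {1..M} \<Longrightarrow> winding_number C (complex_of_real (lam i)) = 1"
    using C lam by (auto simp: positive_simple_closed_contour_def)
  have off: "complex_of_real (lam i) \<notin> path_image C" if "i \<in> {1..M}" for i
    using lam that inside_no_overlap[of "path_image C"] by blast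
  have "((\<lambda>z. z / z) has_contour_integral 0) C"
    by (rule has_contour_integral_spike_simple_path[OF C'(2)
          has_contour_integral_const_loop[OF C'(1,3), of 1], of 0]) simp
  then have int1: "contour_integral C (\<lambda>z. z / z) = 0"
    by (rule contour_integral_unique)
  have "((\<lambda>w. phi_fun (\<lambda>z. z) M L lam w / w * psi_fun M L lam w) has_contour_integral
      2 * of_real pi * \<i> * (1 / of_nat L) * ?S) C"
  proof (rule has_contour_integral_spike_simple_path[OF C'(2), where z = 0])
    show "((\<lambda>w. (1 - 1 / of_nat L * (\<Sum>i=1..M. of_real (lam i) / (of_real (lam i) - w))) *
        (1 - 1 / of_nat L * (\<Sum>i=1..M. (of_real (lam i))\<^sup>2 / (of_real (lam i) - w)\<^sup>2)))
        has_contour_integral 2 * of_real pi * \<i> * (1 / of_nat L) * ?S) C"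
      \<comment> \<open>Here \<open>c\<close> is \<open>1 / of_nat L\<close> and the poles are the
        eigenvalues, each of winding number 1.\<close>
      by (intro has_contour_integral_pole_sum_product C' off wn finite_atLeastAtMost)
  next
    fix w assume w: "w \<in> path_image C" "w \<noteq> 0"
    have "psi_fun M L lam w =
        1 - 1 / of_nat L * (\<Sum>i=1..M. (of_real (lam i))\<^sup>2 / (of_real (lam i) - w)\<^sup>2)"
      using w(1) off by (intro psi_fun_eq) blast
    then show "phi_fun (\<lambda>z. z) M L lam w / w * psi_fun M L lam w =
        (1 - 1 / of_nat L * (\<Sum>i=1..M. of_real (lam i) / (of_real (lam i) - w))) *
        (1 - 1 / of_nat L * (\<Sum>i=1..M. (of_real (lam i))\<^sup>2 / (of_real (lam i) - w)\<^sup>2))"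
      using w(2) by (simp add: phi_fun_def z_fun_def)
  qed
  then have int2: "contour_integral C (\<lambda>w. phi_fun (\<lambda>z. z) M L lam w / w * psi_fun M L lam w) =
      2 * of_real pi * \<i> * (1 / of_nat L) * ?S"
    by (rule contour_integral_unique)
  show ?thesis
    \<comment> \<open>The prefactor \<open>L / M\<close> over \<open>2 * pi * \<i>\<close> meets
      \<open>2 * pi * \<i> / L\<close>, which leaves \<open>1 / M\<close>.\<close>
    unfolding eta_hat_def int1 int2 using M L by simp
qed

theorem theorem3:
  fixes M L :: nat and Y R :: "complex mat" and lam :: "nat \<Rightarrow> real"
    and a b :: real and C :: "real \<Rightarrow> complex"
  assumes "M \<ge> 1" and "L \<ge> 1"
    and "Y \<in> carrier_mat M L"
    and "R = sample_covariance L Y"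
    and "lists_eigenvalues R M lam"
    and "0 < a" and "\<forall>i\<in>{1..M}. lam i \<in> {a..b}"
    and "positive_simple_closed_contour C"
    and "\<forall>i\<in>{1..M}. complex_of_real (lam i) \<in> inside (path_image C)"
  shows "eta_hat (\<lambda>z. z) M L lam C = T_HDL R \<and>
    T_HDL R = 1 / of_nat M * mat_trace R \<and>
    1 / of_nat M * mat_trace R = 1 / of_nat M * (\<Sum>i=1..M. complex_of_real (lam i))"
proof -
  \<comment> \<open>\<open>T_HDL\<close> normalises by the row count of \<open>R\<close>, which the
    carrier condition in \<open>lists_eigenvalues\<close> identifies with \<open>M\<close>.\<close>
  have "dim_row R = M"
    using assms(5) by (auto simp: lists_eigenvalues_def)
  then have "T_HDL R = 1 / of_nat M * mat_trace R"
    by (simp add: T_HDL_def)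
  then show ?thesis
    using mat_trace_eq_sum_eigenvalues[OF assms(5)] eta_hat_ident[OF assms(1,2,8,9)] by simp
qed

end
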